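(* Let $G$ be a graph with $\mu(G)=m$. Then the value of the star-game on $G$ with Maximizer responding (and Minimizer initiating) is at least $\lceil m/2\rceil$. Moreover this bound is sharp: for every positive integer $m$ there is a graph $G$ with $\mu(G)=m$ for which the value of the star-game with Maximizer responding equals $\lceil m/2\rceil$.
   Context: Graphs are finite, simple and undirected. $P_3$ is the path on three vertices; copies of $P_3$ in a graph are subgraphs, not necessarily induced. A $P_3$-packing of $G$ is a collection of vertex-disjoint copies of $P_3$ in $G$, and $\mu(G)$ is the maximum size (number of copies) of a $P_3$-packing of $G$. The star-game on $G$ is played by two players, Maximizer and Minimizer; throughout the game one of them is the initiator and the other is the responder. In each round, the initiator chooses a vertex $v$ of the current graph such that the current graph contains at least one copy of $P_3$ with $v$ as its center vertex (degree-2 vertex of the path); the responder then chooses one copy of $P_3$ in the current graph with $v$ as its center; the three vertices of that copy are removed, and the next round is played on the subgraph induced by the remaining vertices. The game ends when the remaining graph contains no copy of $P_3$. Maximizer tries to maximize, and Minimizer tries to minimize, the number of copies of $P_3$ taken. The value of the game is the number of copies taken under optimal play by both players. *)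

theory Defs
  imports Complex_Main "Graph_Theory.Graph_Theory"
begin

text \<open>
  Finite simple undirected graphs are rendered by the locale \<^locale>\<open>graph\<close>: finite symmetric
  digraphs without loops or multiple arcs, an edge being a pair of opposite arcs.

  A path on three vertices, as a not necessarily induced subgraph, is determined by its centre
  \<open>v\<close> and the unordered pair \<open>S\<close> of its ends; it is encoded as \<open>(v, S)\<close>. In particular
  a triangle contains three copies, with the same vertices but different centres.
\<close>

type_synonym 'a P3 = "'a \<times> 'a set"

definition P3_copies :: "('a, 'b) pre_digraph \<Rightarrow> 'a P3 set" where
  "P3_copies G = {(v, S). v \<in> verts G \<and> S \<subseteq> verts G - {v} \<and> card S = 2 \<and> (\<forall>u\<in>S. v \<rightarrow>\<^bsub>G\<^esub> u)}"

definition P3_centre :: "'a P3 \<Rightarrow> 'a" where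
  "P3_centre c = fst c"

definition P3_verts :: "'a P3 \<Rightarrow> 'a set" where
  "P3_verts c = insert (fst c) (snd c)"

definition P3_copies_at :: "('a, 'b) pre_digraph \<Rightarrow> 'a \<Rightarrow> 'a P3 set" where
  "P3_copies_at G v = {c \<in> P3_copies G. P3_centre c = v}"

definition is_P3_packing :: "('a, 'b) pre_digraph \<Rightarrow> 'a P3 set \<Rightarrow> bool" where
  "is_P3_packing G P \<longleftrightarrow>
     P \<subseteq> P3_copies G \<and> (\<forall>c\<in>P. \<forall>d\<in>P. c \<noteq> d \<longrightarrow> P3_verts c \<inter> P3_verts d = {})"

definition P3_packing_number :: "('a, 'b) pre_digraph \<Rightarrow> nat" where
  "P3_packing_number G = Max {card P | P. is_P3_packing G P}"

lemma finite_P3_copies: "finite (verts G) \<Longrightarrow> finite (P3_copies G)"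
  by (rule finite_subset[of _ "verts G \<times> Pow (verts G)"]) (auto simp: P3_copies_def)

lemma finite_P3_packing_sizes:
  assumes "finite (verts G)"
  shows "finite {card P | P. is_P3_packing G P}" and "{card P | P. is_P3_packing G P} \<noteq> {}"
proof -
  have "{card P | P. is_P3_packing G P} \<subseteq> card ` Pow (P3_copies G)"
    by (auto simp: is_P3_packing_def)
  then show "finite {card P | P. is_P3_packing G P}"
    using finite_P3_copies[OF assms] by (simp add: finite_subset)
  have "is_P3_packing G {}"
    by (simp add: is_P3_packing_def)
  then show "{card P | P. is_P3_packing G P} \<noteq> {}"
    by blast
qed

datatype player = Maximizer | Minimizer

fun opponent :: "player \<Rightarrow> player" where
  "opponent Maximizer = Minimizer"
| "opponent Minimizer = Maximizer"

fun best :: "player \<Rightarrow> nat set \<Rightarrow> nat" where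
  "best Maximizer X = Max X"
| "best Minimizer X = Min X"

text \<open>
  \<open>star_game_value r G\<close> is the value on \<open>G\<close>, by backward induction, when player \<open>r\<close> responds and
  the opponent of \<open>r\<close> initiates. Finiteness of the vertex set is tested only to make the
  recursion total. On a finite graph that contains a copy, the sets handed to \<^const>\<open>best\<close> are finite
  and nonempty.
\<close>

function star_game_value :: "player \<Rightarrow> ('a, 'b) pre_digraph \<Rightarrow> nat" where
  "star_game_value r G =
    (if finite (verts G) \<and> P3_copies G \<noteq> {}
     then best (opponent r)
       ((\<lambda>v. best r
          ((\<lambda>c. 1 + star_game_value r (G \<restriction> (verts G - P3_verts c))) ` P3_copies_at G v))
        ` {v \<in> verts G. P3_copies_at G v \<noteq> {}})
     else 0)"
  by pat_completeness auto
termination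
proof (relation "measure (\<lambda>(r, G). card (verts G))", goal_cases)
  case 1
  show ?case by simp
next
  case (2 r G v c)
  then have "fst c \<in> verts G" "fst c \<in> P3_verts c" "finite (verts G)"
    by (auto simp: P3_copies_at_def P3_copies_def P3_verts_def)
  then have "card (verts G - P3_verts c) < card (verts G)"
    by (intro psubset_card_mono) auto
  then show ?case by simp
qed

declare star_game_value.simps [simp del]

end

theory Submission
  imports Defs
begin

text \<open>
  Lower bound. A copy of \<open>P\<^sub>3\<close> has three vertices, so deleting one could destroy three members of a
  maximum packing \<open>P\<close>; but Maximizer can always respond so that at most two are destroyed. When
  Minimizer names \<open>v\<close>, let Maximizer use a neighbour \<open>x\<close> of \<open>v\<close> that lies in the member of \<open>P\<close>
  through \<open>v\<close>, if there is such a member; the second end \<open>w\<close> is arbitrary. Then every member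
  met by the chosen copy passes through \<open>x\<close> or \<open>w\<close>, and there is at most one of each kind
  (\<open>P3_copy_meeting_two_of_packing\<close>). So the packing number drops by at most two per round, and
  \<open>\<mu>(G)\<close> is at most twice the value (\<open>P3_packing_number_le_double_value\<close>).

  Sharpness. On a path with six vertices \<open>a b c d e f\<close> the packing number is two, but when
  Minimizer names \<open>c\<close> the only copy is \<open>b c d\<close>, and afterwards only the edge \<open>e f\<close> and the isolated
  vertex \<open>a\<close> remain. Disjoint unions of such paths, together with one path \<open>a b c d\<close> when \<open>m\<close> is odd,
  are thus extremal: Minimizer names the vertex \<open>c\<close> of one path after another, which takes
  \<open>\<lceil>m/2\<rceil>\<close> rounds (\<open>star_game_value_six_paths_le\<close>).
\<close>

section \<open>Copies and packings of the path on three vertices\<close>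

lemma P3_copies_induce_subgraph:
  assumes "W \<subseteq> verts G"
  shows "P3_copies (G \<restriction> W) = {c \<in> P3_copies G. P3_verts c \<subseteq> W}"
proof -
  have "(u \<rightarrow>\<^bsub>G \<restriction> W\<^esub> w) \<longleftrightarrow> (u \<rightarrow>\<^bsub>G\<^esub> w) \<and> u \<in> W \<and> w \<in> W" for u w
    by (auto simp: arcs_ends_conv)
  with assms show ?thesis
    by (auto simp: P3_copies_def P3_verts_def)
qed

lemma P3_copies_at_eq: "P3_copies_at G v = Pair v ` {S. (v, S) \<in> P3_copies G}"
  by (auto simp: P3_copies_at_def P3_centre_def)

lemma P3_packing_card_le:
  assumes "finite (verts G)" "is_P3_packing G P"
  shows "card P \<le> P3_packing_number G"
  unfolding P3_packing_number_def
  using finite_P3_packing_sizes[OF assms(1)] assms(2) by (intro Max_ge) auto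

lemma maximum_P3_packing_exists:
  assumes "finite (verts G)"
  obtains P where "is_P3_packing G P" "card P = P3_packing_number G"
  using Max_in[OF finite_P3_packing_sizes[OF assms]] unfolding P3_packing_number_def
  by auto

lemma card_P3_verts:
  assumes "c \<in> P3_copies G"
  shows "card (P3_verts c) = 3" "finite (P3_verts c)" "P3_verts c \<subseteq> verts G"
proof -
  obtain v S where c: "c = (v, S)" "v \<in> verts G" "S \<subseteq> verts G - {v}" "card S = 2"
    using assms by (auto simp: P3_copies_def)
  from \<open>card S = 2\<close> have "finite S"
    by (simp add: card_ge_0_finite)
  moreover have "v \<notin> S"
    using c by auto
  ultimately show "card (P3_verts c) = 3" "finite (P3_verts c)" "P3_verts c \<subseteq> verts G"
    using c by (auto simp: P3_verts_def)
qed

lemma finite_P3_packing: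
  assumes "finite (verts G)" "is_P3_packing G P"
  shows "finite P"
  using finite_P3_copies[OF assms(1)] assms(2) by (auto simp: is_P3_packing_def intro: finite_subset)

lemma P3_packing_card_verts:
  assumes "finite (verts G)" "is_P3_packing G P"
  shows "3 * card P \<le> card (verts G)"
proof -
  have P: "P \<subseteq> P3_copies G" "\<And>c d. c \<in> P \<Longrightarrow> d \<in> P \<Longrightarrow> c \<noteq> d \<Longrightarrow> P3_verts c \<inter> P3_verts d = {}"
    using assms(2) by (auto simp: is_P3_packing_def)
  have "card (\<Union>c\<in>P. P3_verts c) = (\<Sum>c\<in>P. card (P3_verts c))"
  proof (rule card_UN_disjoint)
    show "\<forall>c\<in>P. finite (P3_verts c)"
      using P(1) card_P3_verts(2) by blast
    show "\<forall>c\<in>P. \<forall>d\<in>P. c \<noteq> d \<longrightarrow> P3_verts c \<inter> P3_verts d = {}"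
      using P(2) by blast
  qed (rule finite_P3_packing[OF assms])
  also have "\<dots> = (\<Sum>c\<in>P. 3)"
    using P(1) card_P3_verts(1) by (intro sum.cong) blast+
  finally have "card (\<Union>c\<in>P. P3_verts c) = 3 * card P"
    by simp
  moreover have "(\<Union>c\<in>P. P3_verts c) \<subseteq> verts G"
    using P(1) card_P3_verts(3) by blast
  ultimately show ?thesis
    using card_mono[OF assms(1)] by metis
qed

section \<open>One round with Maximizer responding\<close>

lemma finite_P3_copies_at: "finite (verts G) \<Longrightarrow> finite (P3_copies_at G v)"
  by (simp add: P3_copies_at_def finite_P3_copies)

lemma star_game_value_Maximizer_rec:
  assumes "finite (verts G)" "P3_copies G \<noteq> {}"
  shows "star_game_value Maximizer G =
    (MIN v\<in>{v \<in> verts G. P3_copies_at G v \<noteq> {}}.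
       MAX c\<in>P3_copies_at G v. 1 + star_game_value Maximizer (G \<restriction> (verts G - P3_verts c)))"
  using assms by (subst star_game_value.simps) simp

lemma star_game_value_Maximizer_geI:
  assumes fin: "finite (verts G)" and copies: "P3_copies G \<noteq> {}"
    and respond: "\<And>v. v \<in> verts G \<Longrightarrow> P3_copies_at G v \<noteq> {} \<Longrightarrow>
      \<exists>c\<in>P3_copies_at G v. k \<le> 1 + star_game_value Maximizer (G \<restriction> (verts G - P3_verts c))"
  shows "k \<le> star_game_value Maximizer G"
proof -
  let ?I = "{v \<in> verts G. P3_copies_at G v \<noteq> {}}"
  have "?I \<noteq> {}"
    using copies by (auto simp: P3_copies_at_def P3_copies_def P3_centre_def)
  moreover have "k \<le> (MAX c\<in>P3_copies_at G v.
      1 + star_game_value Maximizer (G \<restriction> (verts G - P3_verts c)))" if "v \<in> ?I" for v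
    using that respond[of v] finite_P3_copies_at[OF fin]
    by (subst Max_ge_iff) auto
  ultimately show ?thesis
    unfolding star_game_value_Maximizer_rec[OF fin copies] using fin by (subst Min_ge_iff) auto
qed

lemma star_game_value_Maximizer_leI:
  assumes fin: "finite (verts G)" and v: "v \<in> verts G" "P3_copies_at G v \<noteq> {}"
    and respond: "\<And>c. c \<in> P3_copies_at G v \<Longrightarrow>
      1 + star_game_value Maximizer (G \<restriction> (verts G - P3_verts c)) \<le> k"
  shows "star_game_value Maximizer G \<le> k"
proof -
  have copies: "P3_copies G \<noteq> {}"
    using v by (auto simp: P3_copies_at_def)
  have "(MAX c\<in>P3_copies_at G v.
      1 + star_game_value Maximizer (G \<restriction> (verts G - P3_verts c))) \<le> k"
    using v respond finite_P3_copies_at[OF fin] by (subst Max_le_iff) auto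
  then show ?thesis
    unfolding star_game_value_Maximizer_rec[OF fin copies]
    using fin v by (subst Min_le_iff) auto
qed

section \<open>The lower bound\<close>

text \<open>
  The neighbour \<open>x\<close> of \<open>v\<close> is chosen so that no member of the packing meets the copy in \<open>v\<close>
  alone. If a member passes through \<open>v\<close> then it is unique, and \<open>v\<close> has a neighbour on it because the
  member is connected; symmetry of the graph is used when \<open>v\<close> is an end of that member.
\<close>

lemma P3_copy_meeting_two_of_packing:
  assumes "graph G" "is_P3_packing G P" "P3_copies_at G v \<noteq> {}"
  obtains c where "c \<in> P3_copies_at G v"
    "card {d \<in> P. P3_verts d \<inter> P3_verts c \<noteq> {}} \<le> 2"
proof -
  interpret graph G by fact
  have P: "P \<subseteq> P3_copies G" "\<And>c d. c \<in> P \<Longrightarrow> d \<in> P \<Longrightarrow> c \<noteq> d \<Longrightarrow> P3_verts c \<inter> P3_verts d = {}"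
    using assms(2) by (auto simp: is_P3_packing_def)
  obtain S where S: "v \<in> verts G" "S \<subseteq> verts G - {v}" "card S = 2" "\<forall>u\<in>S. v \<rightarrow>\<^bsub>G\<^esub> u"
    using assms(3) by (auto simp: P3_copies_at_def P3_copies_def P3_centre_def)
  have "\<exists>x. v \<rightarrow>\<^bsub>G\<^esub> x \<and> (\<forall>d\<in>P. v \<in> P3_verts d \<longrightarrow> x \<in> P3_verts d)"
  proof (cases "\<exists>d\<in>P. v \<in> P3_verts d")
    case True
    then obtain d where d: "d \<in> P" "v \<in> P3_verts d"
      by blast
    obtain y T where yT: "d = (y, T)" "card T = 2" "\<forall>u\<in>T. y \<rightarrow>\<^bsub>G\<^esub> u"
      using d(1) P(1) by (auto simp: P3_copies_def)
    have "\<exists>x\<in>P3_verts d. v \<rightarrow>\<^bsub>G\<^esub> x"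
    proof (cases "v = y")
      case True
      moreover obtain x where "x \<in> T"
        using yT(2) by fastforce
      ultimately show ?thesis
        using yT by (auto simp: P3_verts_def)
    next
      case False
      then have "v \<rightarrow>\<^bsub>G\<^esub> y"
        using d(2) yT by (auto simp: P3_verts_def intro: arcs_ends_symmetric[OF sym_arcs])
      then show ?thesis
        using yT by (auto simp: P3_verts_def)
    qed
    moreover have "e = d" if "e \<in> P" "v \<in> P3_verts e" for e
      using P(2)[of e d] that d by auto
    ultimately show ?thesis
      by metis
  next
    case False
    moreover obtain x where "x \<in> S"
      using S(3) by fastforce
    ultimately show ?thesis
      using S(4) by blast
  qed
  then obtain x where x: "v \<rightarrow>\<^bsub>G\<^esub> x" "\<And>d. d \<in> P \<Longrightarrow> v \<in> P3_verts d \<Longrightarrow> x \<in> P3_verts d"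
    by blast
  obtain w where w: "w \<in> S" "w \<noteq> x"
    using S(3) by (metis card_2_iff insert_iff)
  let ?c = "(v, {x, w})"
  have "x \<noteq> v"
    using x(1) adj_not_same by blast
  then have c: "?c \<in> P3_copies_at G v"
    using x(1) w S adj_in_verts(2)[OF x(1)]
    by (auto simp: P3_copies_at_def P3_copies_def P3_centre_def)
  have at_most_one: "card {d \<in> P. u \<in> P3_verts d} \<le> 1" for u
  proof -
    have "finite {d \<in> P. u \<in> P3_verts d}"
      using finite_P3_packing[OF finite_verts assms(2)] by simp
    moreover have "d = e" if "d \<in> {d \<in> P. u \<in> P3_verts d}" "e \<in> {d \<in> P. u \<in> P3_verts d}" for d e
      using P(2)[of d e] that by blast
    ultimately show ?thesis
      unfolding One_nat_def by (subst card_le_Suc0_iff_eq) blast+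
  qed
  have "{d \<in> P. P3_verts d \<inter> P3_verts ?c \<noteq> {}}
      \<subseteq> {d \<in> P. x \<in> P3_verts d} \<union> {d \<in> P. w \<in> P3_verts d}"
    using x(2) by (auto simp: P3_verts_def[of ?c])
  then have "card {d \<in> P. P3_verts d \<inter> P3_verts ?c \<noteq> {}}
      \<le> card ({d \<in> P. x \<in> P3_verts d} \<union> {d \<in> P. w \<in> P3_verts d})"
    using finite_P3_packing[OF finite_verts assms(2)] by (intro card_mono) auto
  also have "\<dots> \<le> 2"
    using at_most_one[of x] at_most_one[of w] card_Un_le[of "{d \<in> P. x \<in> P3_verts d}" "{d \<in> P. w \<in> P3_verts d}"]
    by linarith
  finally show ?thesis
    using c that by blast
qed

lemma P3_packing_number_delete_copy:
  assumes "graph G" "P3_copies_at G v \<noteq> {}"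
  obtains c where "c \<in> P3_copies_at G v"
    "P3_packing_number G \<le> P3_packing_number (G \<restriction> (verts G - P3_verts c)) + 2"
proof -
  interpret graph G by fact
  obtain P where P: "is_P3_packing G P" "card P = P3_packing_number G"
    using maximum_P3_packing_exists[OF finite_verts] .
  obtain c where c: "c \<in> P3_copies_at G v" "card {d \<in> P. P3_verts d \<inter> P3_verts c \<noteq> {}} \<le> 2"
    using P3_copy_meeting_two_of_packing[OF assms(1) P(1) assms(2)] .
  let ?W = "verts G - P3_verts c"
  let ?Q = "{d \<in> P. P3_verts d \<inter> P3_verts c = {}}"
  have "is_P3_packing (G \<restriction> ?W) ?Q"
    using P(1) card_P3_verts(3)[of _ G]
    by (auto simp: is_P3_packing_def P3_copies_induce_subgraph)
  then have "card ?Q \<le> P3_packing_number (G \<restriction> ?W)"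
    by (intro P3_packing_card_le) auto
  moreover have "card P \<le> card ?Q + card {d \<in> P. P3_verts d \<inter> P3_verts c \<noteq> {}}"
    by (rule order_trans[OF eq_refl card_Un_le], rule arg_cong[of _ _ card]) blast
  ultimately show ?thesis
    using c P(2) by (intro that[of c]) auto
qed

lemma graph_induce_subgraph:
  assumes "graph G" "W \<subseteq> verts G"
  shows "graph (G \<restriction> W)"
proof -
  interpret graph G by fact
  have W: "induced_subgraph (G \<restriction> W) G"
    by (rule induced_induce) fact
  show ?thesis
    by (rule digraph.graphI[OF digraphI_induced[OF W] induced_graph_imp_symmetric[OF sym_arcs W]])
qed

lemma P3_packing_number_le_double_value:
  assumes "graph G"
  shows "P3_packing_number G \<le> 2 * star_game_value Maximizer G"
  using assms
proof (induction "card (verts G)" arbitrary: G rule: less_induct)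
  case less
  then interpret graph G by simp
  show ?case
  proof (cases "P3_copies G = {}")
    case True
    obtain P where "is_P3_packing G P" "card P = P3_packing_number G"
      using maximum_P3_packing_exists[OF finite_verts] .
    with True show ?thesis
      by (auto simp: is_P3_packing_def)
  next
    case False
    have "(P3_packing_number G + 1) div 2 \<le> star_game_value Maximizer G"
    proof (rule star_game_value_Maximizer_geI[OF finite_verts False])
      fix v assume "P3_copies_at G v \<noteq> {}"
      with less.prems obtain c where c: "c \<in> P3_copies_at G v"
        "P3_packing_number G \<le> P3_packing_number (G \<restriction> (verts G - P3_verts c)) + 2"
        by (rule P3_packing_number_delete_copy)
      let ?H = "G \<restriction> (verts G - P3_verts c)"
      have "P3_verts c \<noteq> {}" "P3_verts c \<subseteq> verts G"
        using c(1) card_P3_verts(3)[of c G] by (auto simp: P3_copies_at_def P3_verts_def)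
      then have "card (verts ?H) < card (verts G)"
        by (intro psubset_card_mono) auto
      moreover have "graph ?H"
        by (rule graph_induce_subgraph[OF less.prems]) simp
      ultimately have "P3_packing_number ?H \<le> 2 * star_game_value Maximizer ?H"
        using less.hyps by blast
      then show "\<exists>c\<in>P3_copies_at G v. (P3_packing_number G + 1) div 2
          \<le> 1 + star_game_value Maximizer (G \<restriction> (verts G - P3_verts c))"
        using c by (intro bexI[of _ c]) auto
    qed
    then show ?thesis
      by linarith
  qed
qed

section \<open>Disjoint paths on six vertices\<close>

text \<open>
  The numbers \<open>6j, \<dots>, 6j + 5\<close> form one path in their natural order: successive numbers are
  adjacent unless the smaller one ends such a block. The vertex set is a
  parameter, so that the positions of the game are again graphs of this form.
\<close>

definition six_paths :: "nat set \<Rightarrow> (nat, nat \<times> nat) pre_digraph" where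
  "six_paths V =
     \<lparr>verts = V,
      arcs = {(i, j). i \<in> V \<and> j \<in> V \<and> (j = Suc i \<and> i mod 6 \<noteq> 5 \<or> i = Suc j \<and> j mod 6 \<noteq> 5)},
      tail = fst, head = snd\<rparr>"

lemma verts_six_paths [simp]: "verts (six_paths V) = V"
  by (simp add: six_paths_def)

lemma adj_six_paths:
  "(i \<rightarrow>\<^bsub>six_paths V\<^esub> j) \<longleftrightarrow> i \<in> V \<and> j \<in> V \<and> (j = Suc i \<and> i mod 6 \<noteq> 5 \<or> i = Suc j \<and> j mod 6 \<noteq> 5)"
  by (force simp: arcs_ends_conv six_paths_def)

lemma graph_six_paths:
  assumes "finite V"
  shows "graph (six_paths V)"
proof
  have arcs: "fst e \<in> V \<and> snd e \<in> V \<and> fst e \<noteq> snd e" if "e \<in> arcs (six_paths V)" for e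
  proof -
    have "fst e \<in> V \<and> snd e \<in> V \<and> (snd e = Suc (fst e) \<or> fst e = Suc (snd e))"
      using that by (auto simp: six_paths_def)
    then show ?thesis
      by (metis n_not_Suc_n)
  qed
  then have "arcs (six_paths V) \<subseteq> V \<times> V"
    by (auto simp: mem_Times_iff)
  then show "finite (arcs (six_paths V))"
    using assms finite_subset by blast
  show "symmetric (six_paths V)"
    unfolding symmetric_def by (rule symI) (metis adj_six_paths)
  show "finite (verts (six_paths V))"
    using assms by simp
  fix e assume "e \<in> arcs (six_paths V)"
  then show "tail (six_paths V) e \<in> verts (six_paths V)" "head (six_paths V) e \<in> verts (six_paths V)"
    "tail (six_paths V) e \<noteq> head (six_paths V) e"
    using arcs[of e] by (simp_all add: six_paths_def)
qed (simp add: six_paths_def arc_to_ends_def prod_eq_iff)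

lemma six_paths_induce_subgraph: "W \<subseteq> V \<Longrightarrow> six_paths V \<restriction> W = six_paths W"
  by (auto simp: six_paths_def induce_subgraph_def)

lemma P3_copies_six_paths:
  "(v, S) \<in> P3_copies (six_paths V) \<longleftrightarrow>
     v mod 6 \<in> {1..4} \<and> S = {v - 1, v + 1} \<and> {v - 1, v, v + 1} \<subseteq> V"
proof
  assume "(v, S) \<in> P3_copies (six_paths V)"
  then have S: "card S = 2" "v \<in> V"
    "\<And>u. u \<in> S \<Longrightarrow> u \<in> V \<and> (u = Suc v \<and> v mod 6 \<noteq> 5 \<or> v = Suc u \<and> u mod 6 \<noteq> 5)"
    by (auto simp: P3_copies_def adj_six_paths)
  have "S \<subseteq> {v - 1, v + 1}"
  proof
    fix u assume "u \<in> S"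
    from S(3)[OF this] show "u \<in> {v - 1, v + 1}"
      by auto
  qed
  moreover have "card {v - 1, v + 1} = 2"
    by simp
  ultimately have eq: "S = {v - 1, v + 1}"
    using S(1) by (metis card_subset_eq finite.emptyI finite.insertI)
  have right: "v + 1 \<in> V" "v mod 6 \<noteq> 5"
    using S(3)[of "v + 1"] eq by auto
  have left: "v - 1 \<in> V" "v = Suc (v - 1)" "(v - 1) mod 6 \<noteq> 5"
    using S(3)[of "v - 1"] eq by auto
  have "v mod 6 \<noteq> 0"
    using left(2,3) mod_Suc[of "v - 1" 6] by (auto split: if_splits)
  then have "v mod 6 \<in> {1..4}"
    using right(2) mod_less_divisor[of 6 v] unfolding atLeastAtMost_iff by linarith
  then show "v mod 6 \<in> {1..4} \<and> S = {v - 1, v + 1} \<and> {v - 1, v, v + 1} \<subseteq> V"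
    using eq S(2) left(1) right(1) by simp
next
  assume v: "v mod 6 \<in> {1..4} \<and> S = {v - 1, v + 1} \<and> {v - 1, v, v + 1} \<subseteq> V"
  then obtain u where u: "v = Suc u"
    by (cases v) auto
  then have "u mod 6 \<noteq> 5" "v mod 6 \<noteq> 5"
    using v by (auto simp: mod_Suc)
  then show "(v, S) \<in> P3_copies (six_paths V)"
    using v u by (auto simp: P3_copies_def adj_six_paths)
qed

text \<open>
  Every copy on the path \<open>6j, \<dots>, 6j + 5\<close> uses one of \<open>6j + 1, 6j + 2, 6j + 3\<close>. Minimizer plays
  so that from each path these three vertices are either all present or all removed; the path then
  contains a copy only in the first case, and naming \<open>6j + 2\<close> takes exactly the three.
\<close>

lemma star_game_value_six_paths_le:
  assumes "finite V"
    and "\<And>j. 6 * j + 1 \<in> V \<longleftrightarrow> 6 * j + 2 \<in> V" "\<And>j. 6 * j + 3 \<in> V \<longleftrightarrow> 6 * j + 2 \<in> V"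
  shows "star_game_value Maximizer (six_paths V) \<le> card {j. 6 * j + 2 \<in> V}"
  using assms
proof (induction "card V" arbitrary: V rule: less_induct)
  case less
  have fin: "finite {j. 6 * j + 2 \<in> V}"
    using finite_vimageI[OF less.prems(1), of "\<lambda>j. 6 * j + 2"] by (simp add: vimage_def inj_on_def)
  show ?case
  proof (cases "\<exists>j. 6 * j + 2 \<in> V")
    case True
    then obtain j where j: "6 * j + 2 \<in> V"
      by blast
    then have jV: "{6 * j + 1, 6 * j + 2, 6 * j + 3} \<subseteq> V"
      using less.prems by blast
    let ?c = "(6 * j + 2, {6 * j + 1, 6 * j + 3})"
    let ?W = "V - {6 * j + 1, 6 * j + 2, 6 * j + 3}"
    have "(6 * j + 2, S) \<in> P3_copies (six_paths V) \<longleftrightarrow> S = {6 * j + 1, 6 * j + 3}" for S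
    proof -
      have "(6 * j + 2) mod 6 \<in> {1..4}"
        using mod_mult_self4[of 6 j 2] by (simp del: mod_mult_self4)
      moreover have "6 * j + 2 - 1 = 6 * j + 1" "6 * j + 2 + 1 = 6 * j + 3"
        by simp_all
      ultimately show ?thesis
        using jV unfolding P3_copies_six_paths by (simp only:) simp
    qed
    then have at: "P3_copies_at (six_paths V) (6 * j + 2) = {?c}"
      unfolding P3_copies_at_eq by simp
    have in_W: "6 * i + a \<in> ?W \<longleftrightarrow> 6 * i + a \<in> V \<and> i \<noteq> j" if "a = 1 \<or> a = 2 \<or> a = 3" for i a
    proof -
      have "6 * i + a = 6 * j + 1 \<or> 6 * i + a = 6 * j + 2 \<or> 6 * i + a = 6 * j + 3 \<longleftrightarrow> i = j"
        using that by (elim disjE) (simp, presburger)+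
      then show ?thesis
        by blast
    qed
    have c: "P3_verts ?c = {6 * j + 1, 6 * j + 2, 6 * j + 3}"
      by (auto simp: P3_verts_def)
    have "star_game_value Maximizer (six_paths ?W) \<le> card {i. 6 * i + 2 \<in> ?W}"
    proof (rule less.hyps)
      show "card ?W < card V"
        using j less.prems(1) by (intro psubset_card_mono) auto
      show "6 * i + 1 \<in> ?W \<longleftrightarrow> 6 * i + 2 \<in> ?W" for i
        using less.prems(2)[of i] in_W[of 1 i] in_W[of 2 i] by simp
      show "6 * i + 3 \<in> ?W \<longleftrightarrow> 6 * i + 2 \<in> ?W" for i
        using less.prems(3)[of i] in_W[of 3 i] in_W[of 2 i] by simp
    qed (use less.prems in auto)
    moreover have "{i. 6 * i + 2 \<in> ?W} = {i. 6 * i + 2 \<in> V} - {j}"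
      using in_W[of 2] by auto
    moreover have "card {i. 6 * i + 2 \<in> V} = Suc (card ({i. 6 * i + 2 \<in> V} - {j}))"
      using fin j by (subst card.remove[of _ j]) auto
    ultimately have "1 + star_game_value Maximizer (six_paths ?W) \<le> card {i. 6 * i + 2 \<in> V}"
      by simp
    then have "1 + star_game_value Maximizer (six_paths V \<restriction> (verts (six_paths V) - P3_verts ?c))
        \<le> card {i. 6 * i + 2 \<in> V}"
      unfolding c verts_six_paths six_paths_induce_subgraph[OF Diff_subset] .
    then show ?thesis
      using star_game_value_Maximizer_leI[of "six_paths V" "6 * j + 2", unfolded at verts_six_paths]
        less.prems(1) j
      unfolding verts_six_paths by blast
  next
    case False
    then have none: "6 * j + 1 \<notin> V" "6 * j + 2 \<notin> V" "6 * j + 3 \<notin> V" for j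
      using less.prems by auto
    have "(v, S) \<notin> P3_copies (six_paths V)" for v S
    proof
      assume "(v, S) \<in> P3_copies (six_paths V)"
      then have v: "1 \<le> v mod 6" "v mod 6 \<le> 4" "v - 1 \<in> V" "v \<in> V"
        by (auto simp: P3_copies_six_paths)
      define q where "q = v div 6"
      have "v = 6 * q + 1 \<or> v = 6 * q + 2 \<or> v = 6 * q + 3 \<or> v - 1 = 6 * q + 3"
        unfolding q_def using v(1,2) mult_div_mod_eq[of 6 v] by linarith
      with v(3,4) none[of q] show False
        by metis
    qed
    then have "P3_copies (six_paths V) = {}"
      by auto
    then show ?thesis
      by (subst star_game_value.simps) simp
  qed
qed

text \<open>
  When \<open>m\<close> is odd the last path has the four vertices \<open>6j, \<dots>, 6j + 3\<close>: three would be enough for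
  the packing, but the fourth gives Minimizer the same move \<open>6j + 2\<close> as on the other paths.
\<close>

lemma P3_packing_number_six_paths:
  "P3_packing_number (six_paths {..<3 * m + m mod 2}) = m"
proof (rule antisym)
  let ?G = "six_paths {..<3 * m + m mod 2}"
  obtain P where "is_P3_packing ?G P" "card P = P3_packing_number ?G"
    using maximum_P3_packing_exists[of ?G] by auto
  then have "3 * P3_packing_number ?G \<le> 3 * m + m mod 2"
    using P3_packing_card_verts[of ?G P] by simp
  then show "P3_packing_number ?G \<le> m"
    using mod_less_divisor[of 2 m] by linarith
  let ?c = "\<lambda>i. (3 * i + 1, {3 * i, 3 * i + 2})"
  have "?c i \<in> P3_copies ?G" if "i < m" for i
  proof -
    have "1 \<le> (3 * i + 1) mod 6 \<and> (3 * i + 1) mod 6 \<le> 4"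
      by presburger
    moreover have "3 * i + 1 - 1 = 3 * i" "3 * i + 1 + 1 = 3 * i + 2"
      by simp_all
    moreover have "{3 * i, 3 * i + 1, 3 * i + 2} \<subseteq> {..<3 * m + m mod 2}"
      using that by auto
    ultimately show ?thesis
      unfolding P3_copies_six_paths by (simp only: atLeastAtMost_iff)
  qed
  moreover have "P3_verts (?c i) \<inter> P3_verts (?c k) = {}" if "i \<noteq> k" for i k :: nat
  proof -
    have "x div 3 = i" if "x \<in> P3_verts (?c i)" for x i :: nat
      using that by (auto simp: P3_verts_def)
    with \<open>i \<noteq> k\<close> show ?thesis
      by blast
  qed
  ultimately have "is_P3_packing ?G (?c ` {..<m})"
    unfolding is_P3_packing_def by (metis (no_types, lifting) image_iff image_subsetI lessThan_iff)
  moreover have "card (?c ` {..<m}) = m"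
    by (subst card_image) (auto simp: inj_on_def)
  ultimately show "m \<le> P3_packing_number ?G"
    using P3_packing_card_le[of ?G "?c ` {..<m}"] by simp
qed

lemma star_game_value_six_paths:
  "star_game_value Maximizer (six_paths {..<3 * m + m mod 2}) \<le> (m + 1) div 2"
proof -
  have bound: "(6 * j + 2 < 3 * m + m mod 2 \<longleftrightarrow> j < (m + 1) div 2) \<and>
      (6 * j + 1 < 3 * m + m mod 2 \<longleftrightarrow> j < (m + 1) div 2) \<and>
      (6 * j + 3 < 3 * m + m mod 2 \<longleftrightarrow> j < (m + 1) div 2)" for j
  proof -
    obtain k where "m = 2 * k \<or> m = 2 * k + 1"
      by (metis evenE oddE)
    then show ?thesis
      by (elim disjE) (simp, linarith)+
  qed
  have "star_game_value Maximizer (six_paths {..<3 * m + m mod 2})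
      \<le> card {j. 6 * j + 2 \<in> {..<3 * m + m mod 2}}"
    by (rule star_game_value_six_paths_le) (simp, unfold lessThan_iff, (use bound in blast)+)
  also have "{j. 6 * j + 2 \<in> {..<3 * m + m mod 2}} = {..<(m + 1) div 2}"
    using bound by blast
  finally show ?thesis
    by simp
qed

section \<open>The value with Maximizer responding\<close>

theorem lemma3:
  shows "(\<forall>(G :: ('a, 'b) pre_digraph) m :: nat.
            graph G \<and> P3_packing_number G = m \<longrightarrow>
              int (star_game_value Maximizer G) \<ge> \<lceil>real m / 2\<rceil>) \<and>
         (\<forall>m :: nat. m > 0 \<longrightarrow>
            (\<exists>G :: (nat, nat \<times> nat) pre_digraph.
               graph G \<and> P3_packing_number G = m \<and>
               int (star_game_value Maximizer G) = \<lceil>real m / 2\<rceil>))"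
proof (intro conjI allI impI)
  fix G :: "('a, 'b) pre_digraph" and m :: nat
  assume "graph G \<and> P3_packing_number G = m"
  then have "m \<le> 2 * star_game_value Maximizer G"
    using P3_packing_number_le_double_value by blast
  then show "int (star_game_value Maximizer G) \<ge> \<lceil>real m / 2\<rceil>"
    by linarith
next
  fix m :: nat
  assume "m > 0"
  let ?G = "six_paths {..<3 * m + m mod 2}"
  have G: "graph ?G" "P3_packing_number ?G = m"
    by (auto intro: graph_six_paths simp: P3_packing_number_six_paths)
  then have "m \<le> 2 * star_game_value Maximizer ?G"
    using P3_packing_number_le_double_value by metis
  moreover have "2 * star_game_value Maximizer ?G \<le> m + 1"
    using star_game_value_six_paths[of m] by linarith
  ultimately have "int (star_game_value Maximizer ?G) = \<lceil>real m / 2\<rceil>"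
    by linarith
  with G show "\<exists>G :: (nat, nat \<times> nat) pre_digraph.
      graph G \<and> P3_packing_number G = m \<and> int (star_game_value Maximizer G) = \<lceil>real m / 2\<rceil>"
    by blast
qed

end
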